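(* For all $\alpha\in \mathbb{R}\setminus\mathbb{Q}$, $V\in C_h^\omega(\mathbb{T},\mathbb{R})$ and $E\in\mathbb{R}$, we have $$h(E)=\frac{\hat{L}_1(E)}{2\pi}.$$
   Context: $\mathbb{T}=\mathbb{R}/\mathbb{Z}$; $C^\omega_h(\mathbb{T},\mathbb{R})$ is the set of $1$-periodic real analytic functions that extend analytically to $\{z:|\Im z|<h\}$. Put $A_E(z)=\begin{pmatrix}E-V(z)&-1\\1&0\end{pmatrix}$ and, for real $\varepsilon$ with $|\varepsilon|<h$, $L_\varepsilon(E)=\lim_{n}\frac1n\int_{\mathbb{T}}\ln\|A_E(x+i\varepsilon+(n-1)\alpha)\cdots A_E(x+i\varepsilon)\|\,dx$. The subcritical radius, a quantity used in the study of subcritical Schrödinger operators, is $$h(E)=\sup\{|\varepsilon|:\ L_\varepsilon(E)=0\}.$$ Dual Lyapunov exponents. For a real trigonometric polynomial $W=\sum_{k=-D}^{D}W_ke^{2\pi ikx}$ of degree $D$, the equation $\sum_{k=-D}^{D}W_ku_{n+k}+2\cos 2\pi(\theta+n\alpha)u_n=Eu_n$ defines the dual cocycle $(\alpha,\widehat A_E)$ on $\mathbb{T}\times\mathbb{C}^{2D}$, where $\widehat A_E(\theta+n\alpha)$ maps $(u_{n+D-1},\dots,u_{n-D})^T$ to $(u_{n+D},\dots,u_{n-D+1})^T$; for real $E$ its Lyapunov exponents (with multiplicity) come in pairs $\pm$. For $V=\sum_k\hat V_ke^{2\pi ikx}$ let $V^d=\sum_{k=-d}^{d}\hat V_ke^{2\pi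 ikx}$, and let $0\le\hat L^d_1(E)\le\hat L^d_2(E)\le\cdots$ be the non-negative exponents (one from each $\pm$ pair, with multiplicity) of the dual cocycle of $W=V^d$. The dual Lyapunov exponents of $V$ at $E$ are the non-negative limits $\hat L_i(E)=\lim_{d\to\infty}\hat L_i^d(E)$, $1\le i\le m$, for which $L_{\varepsilon}(E)= L_0(E) -\sum_{\{i:\hat{L}_i(E)< 2\pi|\varepsilon|\}} \hat{L}_i(E)+2\pi(\#\{i:\hat{L}_i(E)<2\pi|\varepsilon|\})|\varepsilon|$ holds for $|\varepsilon|<h$; $\hat L_1(E)$ is the smallest of them.
   Formalization: Assumes at least one dual exponent exists, that L_ε(E)=0 for some |ε|<h (otherwise h(E) is the supremum of an empty set), and that L̂_1(E) ≤ 2πh; without the last, h(E) ≤ h < L̂_1(E)/2π, e.g. V=2λcos 2πx with −ln λ > 2πh and E in the spectrum. *)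

theory Defs
  imports "HOL-Complex_Analysis.Complex_Analysis" "Jordan_Normal_Form.Schur_Decomposition"
begin

section \<open>Analytic potentials on the circle\<close>

text \<open>A function on the circle is a 1-periodic function of a real variable. An element of
  \<open>C_omega h\<close> is represented by its analytic extension to the strip; values outside
  the strip play no role.\<close>

definition C_omega :: "real \<Rightarrow> (complex \<Rightarrow> complex) set" where
  "C_omega h = {V. V holomorphic_on {z. \<bar>Im z\<bar> < h} \<and>
     (\<forall>x::real. V (of_real x) \<in> \<real> \<and> V (of_real (x + 1)) = V (of_real x))}"

definition fourier_coeff :: "(complex \<Rightarrow> complex) \<Rightarrow> int \<Rightarrow> complex" where
  "fourier_coeff V k =
     integral {0..1} (\<lambda>x::real. V (of_real x) * exp (- 2 * of_real pi * \<i> * of_int k * of_real x))"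

section \<open>The complexified Schroedinger cocycle and its Lyapunov exponent\<close>

definition schroedinger_mat :: "(complex \<Rightarrow> complex) \<Rightarrow> real \<Rightarrow> complex \<Rightarrow> complex^2^2" where
  "schroedinger_mat V E z = vector [vector [of_real E - V z, -1], vector [1, 0]]"

primrec schroedinger_iter ::
    "real \<Rightarrow> (complex \<Rightarrow> complex) \<Rightarrow> real \<Rightarrow> nat \<Rightarrow> complex \<Rightarrow> complex^2^2" where
  "schroedinger_iter \<alpha> V E 0 z = Finite_Cartesian_Product.mat 1"
| "schroedinger_iter \<alpha> V E (Suc n) z =
     schroedinger_mat V E (z + of_real (real n * \<alpha>)) ** schroedinger_iter \<alpha> V E n z"

definition lyap :: "real \<Rightarrow> (complex \<Rightarrow> complex) \<Rightarrow> real \<Rightarrow> real \<Rightarrow> real" where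
  "lyap \<alpha> V E \<epsilon> = lim (\<lambda>n. 1 / real n *
     integral {0..1} (\<lambda>x::real. ln (onorm ((*v) (schroedinger_iter \<alpha> V E n (Complex x \<epsilon>))))))"

definition zero_lyap_radii :: "real \<Rightarrow> (complex \<Rightarrow> complex) \<Rightarrow> real \<Rightarrow> real \<Rightarrow> real set" where
  "zero_lyap_radii \<alpha> V h E = {\<bar>\<epsilon>\<bar> | \<epsilon>. \<bar>\<epsilon>\<bar> < h \<and> lyap \<alpha> V E \<epsilon> = 0}"

text \<open>The set of radii is bounded by \<open>h\<close>, so the supremum below exists exactly when the set is
  nonempty, that is, when \<open>E\<close> is subcritical or critical; for the empty set the value carries
  no meaning. In all cases the radius is at most \<open>h\<close>.\<close>

definition subcritical_radius :: "real \<Rightarrow> (complex \<Rightarrow> complex) \<Rightarrow> real \<Rightarrow> real \<Rightarrow> real" where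
  "subcritical_radius \<alpha> V h E = Sup (zero_lyap_radii \<alpha> V h E)"

section \<open>Lyapunov exponents of matrix cocycles over the rotation\<close>

text \<open>Singular values with multiplicity in decreasing order: the nonnegative square roots of the
  eigenvalues of \<open>B\<^sup>* B\<close>.\<close>

definition singular_values :: "complex mat \<Rightarrow> real list" where
  "singular_values B = (THE s. sorted (rev s) \<and> (\<forall>x\<in>set s. 0 \<le> x) \<and>
     char_poly (mat_adjoint B * B) = (\<Prod>x\<leftarrow>s. [:- of_real (x\<^sup>2), 1:]))"

primrec cocycle_iter ::
    "nat \<Rightarrow> real \<Rightarrow> (real \<Rightarrow> complex mat) \<Rightarrow> nat \<Rightarrow> real \<Rightarrow> complex mat" where
  "cocycle_iter N \<alpha> A 0 \<theta> = 1\<^sub>m N"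
| "cocycle_iter N \<alpha> A (Suc n) \<theta> = A (\<theta> + real n * \<alpha>) * cocycle_iter N \<alpha> A n \<theta>"

text \<open>The exponents of an \<open>N\<close>-dimensional cocycle with multiplicity, in decreasing order:
  \<open>lyap_exponent N \<alpha> A j\<close> for \<open>j < N\<close> (counted from 0).\<close>

definition lyap_exponent :: "nat \<Rightarrow> real \<Rightarrow> (real \<Rightarrow> complex mat) \<Rightarrow> nat \<Rightarrow> real" where
  "lyap_exponent N \<alpha> A j = lim (\<lambda>n. 1 / real n *
     integral {0..1} (\<lambda>\<theta>. ln (singular_values (cocycle_iter N \<alpha> A n \<theta>) ! j)))"

section \<open>The dual cocycle of a trigonometric polynomial\<close>

text \<open>A trigonometric polynomial is represented by its family of coefficients
  \<open>W :: int \<Rightarrow> complex\<close> of finite support.\<close>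

definition trig_degree :: "(int \<Rightarrow> complex) \<Rightarrow> nat" where
  "trig_degree W = Max (insert 0 ((\<lambda>k. nat \<bar>k\<bar>) ` {k. W k \<noteq> 0}))"

text \<open>Solving the dual eigenvalue equation for \<open>u (n + D)\<close> gives row 0. Column \<open>j\<close>
  corresponds to the entry \<open>u (n + D - 1 - j)\<close> of the state vector, i.e.\ to the shift
  \<open>k = D - 1 - j\<close>.\<close>

definition dual_mat :: "(int \<Rightarrow> complex) \<Rightarrow> real \<Rightarrow> real \<Rightarrow> complex mat" where
  "dual_mat W E \<theta> = (let D = trig_degree W in
     Matrix.mat (2 * D) (2 * D) (\<lambda>(i, j).
       if i = 0 then
         (let k = int D - 1 - int j in
            ((if k = 0 then of_real (E - 2 * cos (2 * pi * \<theta>)) else 0) - W k) / W (int D))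
       else if i = Suc j then 1 else 0))"

text \<open>The \<open>2 * D\<close> exponents are symmetric about 0, so choosing one from each \<open>\<plusminus>\<close> pair,
  with multiplicity, leaves the \<open>D\<close> largest ones. They are listed here in increasing order
  for \<open>1 \<le> i \<le> D\<close>.\<close>

definition dual_exponent_poly :: "real \<Rightarrow> (int \<Rightarrow> complex) \<Rightarrow> real \<Rightarrow> nat \<Rightarrow> real" where
  "dual_exponent_poly \<alpha> W E i =
     lyap_exponent (2 * trig_degree W) \<alpha> (dual_mat W E) (trig_degree W - i)"

section \<open>Dual Lyapunov exponents of an analytic potential\<close>

definition fourier_trunc :: "nat \<Rightarrow> (complex \<Rightarrow> complex) \<Rightarrow> int \<Rightarrow> complex" where
  "fourier_trunc d V k = (if \<bar>k\<bar> \<le> int d then fourier_coeff V k else 0)"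

definition dual_exponent :: "real \<Rightarrow> (complex \<Rightarrow> complex) \<Rightarrow> real \<Rightarrow> nat \<Rightarrow> real" where
  "dual_exponent \<alpha> V E i = lim (\<lambda>d. dual_exponent_poly \<alpha> (fourier_trunc d V) E i)"

text \<open>\<open>has_dual_exponents \<alpha> V h E m\<close>: the numbers \<open>dual_exponent \<alpha> V E i\<close> for
  \<open>1 \<le> i \<le> m\<close> are the dual Lyapunov exponents of \<open>V\<close> at \<open>E\<close>. The \<open>i\<close>-th exponent of
  the \<open>d\<close>-th truncation only exists once the degree of that truncation, which may be smaller
  than \<open>d\<close>, has reached \<open>i\<close>. Exponents that are at least \<open>2 * pi * h\<close> may be included or left
  out: they never enter the formula within the strip.\<close>

definition has_dual_exponents ::
    "real \<Rightarrow> (complex \<Rightarrow> complex) \<Rightarrow> real \<Rightarrow> real \<Rightarrow> nat \<Rightarrow> bool" where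
  "has_dual_exponents \<alpha> V h E m \<longleftrightarrow>
     (\<forall>i\<in>{1..m}.
        (\<forall>\<^sub>F d in sequentially. i \<le> trig_degree (fourier_trunc d V)) \<and>
        convergent (\<lambda>d. dual_exponent_poly \<alpha> (fourier_trunc d V) E i) \<and>
        0 \<le> dual_exponent \<alpha> V E i) \<and>
     (\<forall>\<epsilon>. \<bar>\<epsilon>\<bar> < h \<longrightarrow>
        (let J = {i \<in> {1..m}. dual_exponent \<alpha> V E i < 2 * pi * \<bar>\<epsilon>\<bar>} in
          lyap \<alpha> V E \<epsilon> =
            lyap \<alpha> V E 0 - (\<Sum>i\<in>J. dual_exponent \<alpha> V E i) + 2 * pi * real (card J) * \<bar>\<epsilon>\<bar>))"

definition least_dual_exponent :: "real \<Rightarrow> (complex \<Rightarrow> complex) \<Rightarrow> real \<Rightarrow> nat \<Rightarrow> real" where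
  "least_dual_exponent \<alpha> V E m = Min (dual_exponent \<alpha> V E ` {1..m})"

end

theory Submission
  imports Defs
begin

text \<open>
  On the strip the defining formula of the dual exponents says
  \<open>L \<epsilon> = L 0 + (\<Sum>i\<in>J \<epsilon>. 2 * pi * \<bar>\<epsilon>\<bar> - l i)\<close>, where \<open>J \<epsilon>\<close> collects the indices with
  \<open>l i < 2 * pi * \<bar>\<epsilon>\<bar>\<close>. All summands are positive, so \<open>L \<epsilon> \<ge> L 0\<close>, with equality exactly
  when \<open>2 * pi * \<bar>\<epsilon>\<bar>\<close> does not exceed the least exponent (\<open>sum_gaps_eq_0_iff\<close>).
  Moreover \<open>L 0 \<ge> 0\<close> (\<open>lyap_nonneg\<close>). Hence if \<open>L\<close> vanishes at some point of the strip then
  \<open>L 0 = 0\<close>, the zeros of \<open>L\<close> in the strip are exactly the \<open>\<epsilon>\<close> with \<open>2 * pi * \<bar>\<epsilon>\<bar> \<le> l\<close> for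
  the least exponent \<open>l\<close>, and the supremum of their moduli is \<open>l / (2 * pi)\<close>.

  The nonnegativity of \<open>L 0\<close> has two ingredients. The iterates have determinant 1, so their
  norms are at least 1 and every term of the sequence defining \<open>L 0\<close> is nonnegative. This
  bounds the limit only if the sequence converges, which follows from Fekete's lemma: the
  integrals \<open>\<integral> ln \<parallel>A\<^sub>n\<parallel>\<close> are subadditive in \<open>n\<close>, because the norm is submultiplicative and
  translation by \<open>n * \<alpha>\<close> preserves integrals over the circle.
\<close>

no_notation fps_nth (infixl "$" 75) and Matrix.vec_index (infixl "$" 100)

section \<open>Subadditive sequences\<close>

text \<open>Fekete's lemma. Writing \<open>n = q * k + r\<close> with \<open>r < k\<close>, subadditivity bounds \<open>a n\<close> by
  \<open>q * a k\<close> up to a constant that depends only on \<open>k\<close>, so that \<open>a n / n\<close> eventually drops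
  below anything larger than \<open>a k / k\<close>.\<close>

lemma fekete_subadditive:
  fixes a :: "nat \<Rightarrow> real"
  assumes sub: "\<And>m n. a (m + n) \<le> a m + a n"
    and bdd: "bdd_below ((\<lambda>n. a n / real n) ` {1..})"
  shows "(\<lambda>n. a n / real n) \<longlonglongrightarrow> (INF n\<in>{1..}. a n / real n)"
proof (rule order_tendstoI)
  let ?L = "INF n\<in>{1..}. a n / real n"
  fix c assume "c < ?L"
  have "c < a n / real n" if "n \<ge> 1" for n
    using cINF_lower[OF bdd, of n] that \<open>c < ?L\<close> by auto
  then show "\<forall>\<^sub>F n in sequentially. c < a n / real n"
    using eventually_sequentially by blast
next
  let ?L = "INF n\<in>{1..}. a n / real n"
  fix c assume "?L < c"
  then obtain k where k: "k \<ge> 1" "a k / real k < c"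
    using cINF_less_iff[OF _ bdd, of c] by auto
  have mult: "a (q * k + r) \<le> real q * a k + a r" for q r
  proof (induction q)
    case (Suc q)
    have "a (Suc q * k + r) \<le> a k + a (q * k + r)"
      using sub[of k "q * k + r"] by (simp add: add.assoc)
    with Suc show ?case by (simp add: algebra_simps)
  qed simp
  \<comment> \<open>Subtracting \<open>r * (a k / k)\<close> absorbs the difference between \<open>q * k\<close> and \<open>n\<close>, whatever
    the sign of \<open>a k\<close>.\<close>
  define M where "M = Max ((\<lambda>r. a r - real r * (a k / real k)) ` {..<k})"
  have bound: "a n / real n \<le> a k / real k + M / real n" if "n \<ge> 1" for n
  proof -
    have "a n \<le> real (n div k) * a k + a (n mod k)"
      using mult[of "n div k" "n mod k"] by simp
    moreover have "real n = real (n div k) * real k + real (n mod k)"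
      by (metis div_mult_mod_eq of_nat_add of_nat_mult)
    then have "real (n div k) * a k = (real n - real (n mod k)) * (a k / real k)"
      using k by simp
    moreover have "a (n mod k) - real (n mod k) * (a k / real k) \<le> M"
      unfolding M_def using k by (intro Max_ge) auto
    ultimately have "a n \<le> real n * (a k / real k) + M"
      by (simp add: algebra_simps)
    then have "a n / real n \<le> (real n * (a k / real k) + M) / real n"
      by (rule divide_right_mono) simp
    then show ?thesis using that by (simp add: add_divide_distrib)
  qed
  have "(\<lambda>n. a k / real k + M / real n) \<longlonglongrightarrow> a k / real k + 0"
    by (intro tendsto_intros lim_const_over_n)
  then have "\<forall>\<^sub>F n in sequentially. a k / real k + M / real n < c"
    using k(2) by (intro order_tendstoD(2)) auto
  with eventually_ge_at_top[of 1] show "\<forall>\<^sub>F n in sequentially. a n / real n < c"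
    by eventually_elim (use bound in force)
qed

section \<open>Translation invariance on the circle\<close>

lemma integral_periodic_shift:
  fixes f :: "real \<Rightarrow> real"
  assumes cont: "continuous_on UNIV f" and per: "\<And>x. f (x + 1) = f x"
  shows "integral {0..1} (\<lambda>x. f (x + c)) = integral {0..1} f"
proof -
  interpret periodic_fun_simple' f by unfold_locales (rule per)
  have int: "f integrable_on {u..v}" for u v
    by (rule integrable_continuous_real) (rule continuous_on_subset[OF cont], simp)
  have shift: "integral {u..v} (\<lambda>x. f (x + d)) = integral {u + d..v + d} f" for u v d
    using integral_shift_real_ivl[of "u + d" d "v + d" f] by simp
  \<comment> \<open>By periodicity the shift may be taken in the unit interval, where the part of the
    interval pushed out at 1 reenters at 0.\<close>
  define b where "b = frac c"
  have b: "0 \<le> b" "b \<le> 1"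
    by (auto simp: b_def frac_ge_0 frac_lt_1 less_imp_le)
  have "f (x + c) = f (x + b)" for x
    using plus_of_int[of "x + b" "\<lfloor>c\<rfloor>"] by (simp add: b_def frac_def)
  then have "integral {0..1} (\<lambda>x. f (x + c)) = integral {b..1 + b} f"
    using shift[of 0 1 b] by simp
  also have "\<dots> = integral {b..1} f + integral {1..1 + b} f"
    using b by (intro Henstock_Kurzweil_Integration.integral_combine[symmetric] int) auto
  also have "integral {1..1 + b} f = integral {0..b} f"
    using shift[of 0 b 1] by (simp add: per add.commute)
  also have "integral {b..1} f + integral {0..b} f = integral {0..1} f"
    using b Henstock_Kurzweil_Integration.integral_combine[of 0 b 1 f] int by simp
  finally show ?thesis .
qed

section \<open>The operator norm of matrices\<close>

lemma onorm_matrix_mul_le: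
  fixes A :: "complex^'n^'m" and B :: "complex^'k^'n"
  shows "onorm ((*v) (A ** B)) \<le> onorm ((*v) A) * onorm ((*v) B)"
proof -
  have "(*v) (A ** B) = (*v) A \<circ> (*v) B"
    by (auto simp: matrix_vector_mul_assoc)
  then show ?thesis
    using onorm_compose[of "(*v) A" "(*v) B"] by simp
qed

text \<open>The operator norm is the norm of a linear image of the matrix in a normed space, and
  linear maps on the finite-dimensional space of matrices are continuous.\<close>

lemma continuous_on_onorm_matrix:
  "continuous_on UNIV (\<lambda>A :: complex^'n^'m. onorm ((*v) A))"
proof -
  let ?F = "\<lambda>A :: complex^'n^'m. Blinfun ((*v) A)"
  have app: "blinfun_apply (?F A) = (*v) A" for A
    by (rule bounded_linear_Blinfun_apply) simp
  have "linear ?F"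
  proof (rule linearI; rule blinfun_eqI)
    fix A B :: "complex^'n^'m" and r :: real and x
    show "blinfun_apply (?F (A + B)) x = blinfun_apply (?F A + ?F B) x"
      by (simp add: app blinfun.add_left matrix_vector_mult_add_rdistrib)
    show "blinfun_apply (?F (r *\<^sub>R A)) x = blinfun_apply (r *\<^sub>R ?F A) x"
      by (simp add: app blinfun.scaleR_left matrix_vector_mult_def scaleR_sum_right
          Finite_Cartesian_Product.vec_eq_iff)
  qed
  then have "continuous_on UNIV (\<lambda>A. norm (?F A))"
    by (intro continuous_on_norm linear_continuous_on) (simp add: linear_conv_bounded_linear)
  then show ?thesis by (simp add: norm_blinfun.rep_eq app)
qed

text \<open>Hadamard's inequality bounds the determinant by the product of the norms of the columns,
  which are images of unit vectors.\<close>

lemma norm_det_le_onorm_squared: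
  fixes A :: "complex^2^2"
  shows "norm (Determinants.det A) \<le> (onorm ((*v) A))\<^sup>2"
proof -
  let ?N = "onorm ((*v) A)"
  have col: "sqrt ((norm (A$1$j))\<^sup>2 + (norm (A$2$j))\<^sup>2) \<le> ?N" for j
  proof -
    have "A *v axis j 1 = (\<chi> i. A$i$j)"
      by (simp add: matrix_vector_mult_def axis_def Finite_Cartesian_Product.vec_eq_iff
          if_distrib[of "(*) _"] cong: if_cong)
    then have "norm (\<chi> i. A$i$j) \<le> ?N"
      using onorm[of "(*v) A" "axis j 1"] by (simp add: norm_axis_1)
    then show ?thesis by (simp add: norm_vec_def L2_set_def sum_2)
  qed
  have "norm (Determinants.det A) \<le> norm (A$1$1) * norm (A$2$2) + norm (A$1$2) * norm (A$2$1)"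
    unfolding det_2 norm_mult[symmetric] by (rule norm_triangle_ineq4)
  also have "\<dots> \<le> sqrt ((norm (A$1$1))\<^sup>2 + (norm (A$2$1))\<^sup>2) *
                   sqrt ((norm (A$1$2))\<^sup>2 + (norm (A$2$2))\<^sup>2)"
  proof -
    have "0 \<le> (norm (A$1$1) * norm (A$1$2) - norm (A$2$1) * norm (A$2$2))\<^sup>2"
      by simp
    then show ?thesis
      unfolding real_sqrt_mult[symmetric]
      by (intro real_le_rsqrt) (simp add: power2_eq_square algebra_simps)
  qed
  also have "\<dots> \<le> ?N * ?N"
    by (intro mult_mono col) (simp_all add: onorm_pos_le)
  finally show ?thesis by (simp add: power2_eq_square)
qed

section \<open>The Schroedinger cocycle\<close>

lemma schroedinger_iter_add:
  "schroedinger_iter \<alpha> V E (m + n) z =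
     schroedinger_iter \<alpha> V E m (z + of_real (real n * \<alpha>)) ** schroedinger_iter \<alpha> V E n z"
  by (induction m) (simp_all add: matrix_mul_assoc algebra_simps)

lemma det_schroedinger_iter: "Determinants.det (schroedinger_iter \<alpha> V E n z) = 1"
proof (induction n)
  case (Suc n)
  have "Determinants.det (schroedinger_mat V E w) = 1" for w
    by (simp add: det_2 schroedinger_mat_def)
  with Suc show ?case by (simp add: Determinants.det_mul)
qed simp

lemma onorm_schroedinger_iter_ge_1: "1 \<le> onorm ((*v) (schroedinger_iter \<alpha> V E n z))"
proof -
  have "1\<^sup>2 \<le> (onorm ((*v) (schroedinger_iter \<alpha> V E n z)))\<^sup>2"
    using norm_det_le_onorm_squared[of "schroedinger_iter \<alpha> V E n z"]
    by (simp add: det_schroedinger_iter)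
  then show ?thesis
    by (rule power2_le_imp_le) (simp add: onorm_pos_le)
qed

lemma continuous_on_matrix_mul:
  fixes f :: "'a::topological_space \<Rightarrow> complex^'n^'m" and g :: "'a \<Rightarrow> complex^'k^'n"
  assumes "continuous_on S f" "continuous_on S g"
  shows "continuous_on S (\<lambda>x. f x ** g x)"
  unfolding matrix_matrix_mult_def
  using assms by (intro continuous_intros continuous_on_component)

lemma continuous_on_schroedinger_iter:
  assumes cont: "continuous_on UNIV (\<lambda>x. V (Complex x \<epsilon>))"
  shows "continuous_on UNIV (\<lambda>x. schroedinger_iter \<alpha> V E n (Complex x \<epsilon>))"
proof (induction n)
  case (Suc n)
  have shift: "continuous_on UNIV (\<lambda>x. V (Complex (x + t) \<epsilon>))" for t
    by (rule continuous_on_compose2[OF cont, of _ "\<lambda>x. x + t"]) (auto intro!: continuous_intros)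
  have "continuous_on UNIV (\<lambda>x. schroedinger_mat V E (Complex (x + t) \<epsilon>))" for t
  proof -
    have "schroedinger_mat V E z =
        (\<chi> i j. if i = 1 then if j = 1 then of_real E - V z else -1 else if j = 1 then 1 else 0)" for z
      by (simp add: schroedinger_mat_def Finite_Cartesian_Product.vec_eq_iff forall_2)
    moreover have "continuous_on UNIV (\<lambda>x. if i = 1 then if j = 1 then of_real E - V (Complex (x + t) \<epsilon>)
        else -1 else if j = 1 then 1 else 0)" for i j :: 2
      by (cases "i = 1"; cases "j = 1") (auto intro!: continuous_intros shift)
    ultimately show ?thesis
      by (simp add: continuous_on_vec_lambda)
  qed
  with Suc show ?case
    by (simp add: continuous_on_matrix_mul Complex_add_complex_of_real del: of_real_mult)
qed simp

lemma schroedinger_iter_periodic: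
  assumes per: "\<And>x. V (Complex (x + 1) \<epsilon>) = V (Complex x \<epsilon>)"
  shows "schroedinger_iter \<alpha> V E n (Complex (x + 1) \<epsilon>) = schroedinger_iter \<alpha> V E n (Complex x \<epsilon>)"
proof (induction n)
  case (Suc n)
  have "V (Complex (x + 1) \<epsilon> + of_real t) = V (Complex x \<epsilon> + of_real t)" for t
    using per[of "x + t"] unfolding Complex_add_complex_of_real by (simp add: algebra_simps)
  with Suc show ?case by (simp add: schroedinger_mat_def del: of_real_mult)
qed simp

text \<open>Subadditivity of the integrated logarithmic norms provides the limit that \<open>lyap\<close>
  refers to; without it, the signs of the terms would say nothing about \<open>lyap\<close>.\<close>

lemma lyap_nonneg:
  assumes cont: "continuous_on UNIV (\<lambda>x. V (Complex x \<epsilon>))"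
    and per: "\<And>x. V (Complex (x + 1) \<epsilon>) = V (Complex x \<epsilon>)"
  shows "0 \<le> lyap \<alpha> V E \<epsilon>"
proof -
  define f where "f n x = ln (onorm ((*v) (schroedinger_iter \<alpha> V E n (Complex x \<epsilon>))))" for n x
  define a where "a n = integral {0..1} (f n)" for n
  have f_nonneg: "0 \<le> f n x" for n x
    by (simp add: f_def onorm_schroedinger_iter_ge_1)
  have f_cont: "continuous_on UNIV (f n)" for n
  proof -
    have "continuous_on UNIV (\<lambda>x. onorm ((*v) (schroedinger_iter \<alpha> V E n (Complex x \<epsilon>))))"
      by (rule continuous_on_compose2[OF continuous_on_onorm_matrix
            continuous_on_schroedinger_iter[OF cont]]) simp
    moreover have "onorm ((*v) (schroedinger_iter \<alpha> V E n (Complex x \<epsilon>))) \<noteq> 0" for x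
      using onorm_schroedinger_iter_ge_1[of \<alpha> V E n "Complex x \<epsilon>"] by linarith
    ultimately show ?thesis
      unfolding f_def by (intro continuous_on_ln) auto
  qed
  have f_shift_cont: "continuous_on UNIV (\<lambda>x. f n (x + t))" for n t
    by (rule continuous_on_compose2[OF f_cont, of _ "\<lambda>x. x + t"]) (auto intro!: continuous_intros)
  have int: "g integrable_on {0..1}" if "continuous_on UNIV g" for g :: "real \<Rightarrow> real"
    by (rule integrable_continuous_real) (rule continuous_on_subset[OF that], simp)
  have f_sub: "f (m + n) x \<le> f m (x + real n * \<alpha>) + f n x" for m n x
  proof -
    let ?A = "schroedinger_iter \<alpha> V E m (Complex (x + real n * \<alpha>) \<epsilon>)"
    let ?B = "schroedinger_iter \<alpha> V E n (Complex x \<epsilon>)"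
    have ge: "1 \<le> onorm ((*v) ?A)" "1 \<le> onorm ((*v) ?B)"
      by (rule onorm_schroedinger_iter_ge_1)+
    have AB: "schroedinger_iter \<alpha> V E (m + n) (Complex x \<epsilon>) = ?A ** ?B"
      by (simp add: schroedinger_iter_add Complex_add_complex_of_real del: of_real_mult)
    have "f (m + n) x \<le> ln (onorm ((*v) ?A) * onorm ((*v) ?B))"
      unfolding f_def AB
      using onorm_matrix_mul_le[of ?A ?B]
        onorm_schroedinger_iter_ge_1[of \<alpha> V E "m + n" "Complex x \<epsilon>"]
      by (intro ln_mono) (auto simp: AB)
    also have "\<dots> = f m (x + real n * \<alpha>) + f n x"
      using ge unfolding f_def by (intro ln_mult_pos) linarith+
    finally show ?thesis .
  qed
  have a_sub: "a (m + n) \<le> a m + a n" for m n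
  proof -
    have "a (m + n) \<le> integral {0..1} (\<lambda>x. f m (x + real n * \<alpha>) + f n x)"
      unfolding a_def
      by (intro integral_le int f_sub continuous_on_add f_cont f_shift_cont)
    also have "\<dots> = integral {0..1} (\<lambda>x. f m (x + real n * \<alpha>)) + a n"
      unfolding a_def by (intro integral_add int f_cont f_shift_cont)
    also have "integral {0..1} (\<lambda>x. f m (x + real n * \<alpha>)) = a m"
      unfolding a_def
      by (rule integral_periodic_shift[OF f_cont]) (simp add: f_def schroedinger_iter_periodic[of V, OF per])
    finally show ?thesis .
  qed
  have a_nonneg: "0 \<le> a n / real n" for n
    unfolding a_def by (intro divide_nonneg_nonneg integral_nonneg int f_cont f_nonneg) simp
  then have "bdd_below ((\<lambda>n. a n / real n) ` {1..})"
    by (intro bdd_belowI2)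
  from fekete_subadditive[OF a_sub this]
  have "convergent (\<lambda>n. a n / real n)" by (rule convergentI)
  then have "(\<lambda>n. a n / real n) \<longlonglongrightarrow> lim (\<lambda>n. a n / real n)"
    by (simp add: convergent_LIMSEQ_iff)
  then have "0 \<le> lim (\<lambda>n. a n / real n)"
    by (rule LIMSEQ_le_const) (use a_nonneg in blast)
  then show ?thesis
    by (simp add: lyap_def a_def f_def[abs_def])
qed

section \<open>The zero set of the Lyapunov exponent\<close>

lemma
  fixes l :: "'a \<Rightarrow> real"
  assumes "finite I"
  defines "J \<equiv> \<lambda>t. {i \<in> I. l i < t}"
  shows sum_gaps_nonneg: "0 \<le> real (card (J t)) * t - (\<Sum>i\<in>J t. l i)"
    and sum_gaps_eq_0_iff:
      "real (card (J t)) * t - (\<Sum>i\<in>J t. l i) = 0 \<longleftrightarrow> (\<forall>i\<in>I. t \<le> l i)"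
proof -
  have fin: "finite (J t)" using assms by (simp add: J_def)
  have eq: "real (card (J t)) * t - (\<Sum>i\<in>J t. l i) = (\<Sum>i\<in>J t. t - l i)"
    by (simp add: sum_subtractf)
  show "0 \<le> real (card (J t)) * t - (\<Sum>i\<in>J t. l i)"
    unfolding eq by (rule sum_nonneg) (simp add: J_def)
  have "(\<Sum>i\<in>J t. t - l i) = 0 \<longleftrightarrow> (\<forall>i\<in>J t. t - l i = 0)"
    by (rule sum_nonneg_eq_0_iff[OF fin]) (simp add: J_def)
  also have "\<dots> \<longleftrightarrow> (\<forall>i\<in>I. t \<le> l i)"
    by (force simp: J_def not_less)
  finally show "real (card (J t)) * t - (\<Sum>i\<in>J t. l i) = 0 \<longleftrightarrow> (\<forall>i\<in>I. t \<le> l i)"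
    unfolding eq .
qed

lemma Sup_truncated_radii:
  fixes h r :: real
  assumes "0 < h" "0 \<le> r" "r \<le> h"
  shows "Sup {\<bar>\<epsilon>\<bar> | \<epsilon>. \<bar>\<epsilon>\<bar> < h \<and> \<bar>\<epsilon>\<bar> \<le> r} = r"
proof (cases "r < h")
  case True
  have "{\<bar>\<epsilon>\<bar> | \<epsilon>. \<bar>\<epsilon>\<bar> < h \<and> \<bar>\<epsilon>\<bar> \<le> r} = {0..r}"
  proof (intro equalityI subsetI)
    fix t assume "t \<in> {0..r}"
    then have "t = \<bar>t\<bar> \<and> \<bar>t\<bar> < h \<and> \<bar>t\<bar> \<le> r" using True by auto
    then show "t \<in> {\<bar>\<epsilon>\<bar> | \<epsilon>. \<bar>\<epsilon>\<bar> < h \<and> \<bar>\<epsilon>\<bar> \<le> r}" by blast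
  qed auto
  then show ?thesis using assms by simp
next
  case False
  \<comment> \<open>Now \<open>r = h\<close>, and the supremum is not attained because the strip is open.\<close>
  have "{\<bar>\<epsilon>\<bar> | \<epsilon>. \<bar>\<epsilon>\<bar> < h \<and> \<bar>\<epsilon>\<bar> \<le> r} = {0..<r}"
  proof (intro equalityI subsetI)
    fix t assume "t \<in> {0..<r}"
    then have "t = \<bar>t\<bar> \<and> \<bar>t\<bar> < h \<and> \<bar>t\<bar> \<le> r" using assms by auto
    then show "t \<in> {\<bar>\<epsilon>\<bar> | \<epsilon>. \<bar>\<epsilon>\<bar> < h \<and> \<bar>\<epsilon>\<bar> \<le> r}" by blast
  qed (use False assms in auto)
  then show ?thesis using False assms by simp
qed

theorem corollary1p2:
  fixes \<alpha> h E :: real and V :: "complex \<Rightarrow> complex" and m :: nat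
  assumes "\<alpha> \<notin> \<rat>"
    and "0 < h"
    and "V \<in> C_omega h"
    and "has_dual_exponents \<alpha> V h E m"
    and "1 \<le> m"
    and "least_dual_exponent \<alpha> V E m \<le> 2 * pi * h"
    and "zero_lyap_radii \<alpha> V h E \<noteq> {}"
  shows "subcritical_radius \<alpha> V h E = least_dual_exponent \<alpha> V E m / (2 * pi)"
proof -
  define l where "l = dual_exponent \<alpha> V E"
  define r where "r = least_dual_exponent \<alpha> V E m / (2 * pi)"
  define J where "J t = {i \<in> {1..m}. l i < t}" for t
  \<comment> \<open>The excess of \<open>lyap\<close> over its value at 0, as a function of \<open>t = 2 * pi * \<bar>\<epsilon>\<bar>\<close>.\<close>
  define S where "S t = real (card (J t)) * t - (\<Sum>i\<in>J t. l i)" for t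
  have l_nonneg: "0 \<le> l i" if "i \<in> {1..m}" for i
    using assms(4) that by (auto simp: has_dual_exponents_def l_def)
  have formula: "lyap \<alpha> V E \<epsilon> = lyap \<alpha> V E 0 + S (2 * pi * \<bar>\<epsilon>\<bar>)" if "\<bar>\<epsilon>\<bar> < h" for \<epsilon>
  proof -
    have "lyap \<alpha> V E \<epsilon> = lyap \<alpha> V E 0 - (\<Sum>i\<in>J (2 * pi * \<bar>\<epsilon>\<bar>). l i)
        + 2 * pi * real (card (J (2 * pi * \<bar>\<epsilon>\<bar>))) * \<bar>\<epsilon>\<bar>"
      using assms(4) that unfolding has_dual_exponents_def Let_def J_def l_def by blast
    then show ?thesis by (simp add: S_def)
  qed
  have S_nonneg: "0 \<le> S t" for t
    unfolding S_def J_def by (rule sum_gaps_nonneg) simp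
  have S_zero: "S (2 * pi * \<bar>\<epsilon>\<bar>) = 0 \<longleftrightarrow> \<bar>\<epsilon>\<bar> \<le> r" for \<epsilon>
  proof -
    have "S (2 * pi * \<bar>\<epsilon>\<bar>) = 0 \<longleftrightarrow> (\<forall>i\<in>{1..m}. 2 * pi * \<bar>\<epsilon>\<bar> \<le> l i)"
      unfolding S_def J_def by (rule sum_gaps_eq_0_iff) simp
    also have "\<dots> \<longleftrightarrow> 2 * pi * \<bar>\<epsilon>\<bar> \<le> least_dual_exponent \<alpha> V E m"
      using assms(5) by (simp add: least_dual_exponent_def l_def)
    also have "\<dots> \<longleftrightarrow> \<bar>\<epsilon>\<bar> \<le> r"
      by (simp add: r_def field_simps)
    finally show ?thesis .
  qed
  have "0 \<le> lyap \<alpha> V E 0"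
  proof (rule lyap_nonneg)
    have hol: "V holomorphic_on {z. \<bar>Im z\<bar> < h}"
      and per: "\<And>x::real. V (of_real (x + 1)) = V (of_real x)"
      using assms(3) by (auto simp: C_omega_def)
    show "continuous_on UNIV (\<lambda>x. V (Complex x 0))"
      unfolding complex_of_real_def[symmetric]
      by (rule continuous_on_compose2[OF holomorphic_on_imp_continuous_on[OF hol]])
        (use assms(2) in \<open>auto intro!: continuous_intros\<close>)
    show "V (Complex (x + 1) 0) = V (Complex x 0)" for x
      using per[of x] unfolding complex_of_real_def .
  qed
  moreover obtain \<epsilon>\<^sub>0 where "\<bar>\<epsilon>\<^sub>0\<bar> < h" "lyap \<alpha> V E \<epsilon>\<^sub>0 = 0"
    using assms(7) by (auto simp: zero_lyap_radii_def)
  ultimately have "lyap \<alpha> V E 0 = 0"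
    using formula[of \<epsilon>\<^sub>0] S_nonneg[of "2 * pi * \<bar>\<epsilon>\<^sub>0\<bar>"] by linarith
  then have "zero_lyap_radii \<alpha> V h E = {\<bar>\<epsilon>\<bar> | \<epsilon>. \<bar>\<epsilon>\<bar> < h \<and> \<bar>\<epsilon>\<bar> \<le> r}"
    using formula S_zero by (auto simp: zero_lyap_radii_def)
  moreover have "0 \<le> r" "r \<le> h"
    using assms(5,6) l_nonneg by (auto simp: r_def least_dual_exponent_def l_def field_simps)
  ultimately show ?thesis
    using Sup_truncated_radii[OF assms(2)] by (simp add: subcritical_radius_def r_def)
qed

end
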